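(* Let $A$ be a finite-dimensional algebra over a field $\mathbb{K}$ and $S$ a subset of $A$. Every lattice definable over $S$ is contained, in the sense of the order $\leq_{\mathrm{latt}}$, in a maximal (for $\leq_{\mathrm{latt}}$) lattice definable over $S$. Likewise, every lattice definable below $S$ is contained, in the sense of the order $\leq_{\mathrm{latt}}$, in a maximal (for $\leq_{\mathrm{latt}}$) lattice definable below $S$.
   Context: An algebra over a field $\mathbb{K}$ is a $\mathbb{K}$-vector space with a bilinear multiplication (not necessarily associative or commutative). "Ideal" means two-sided ideal. A natural basis of an algebra is a vector space basis $\{e_i\}$ with $e_ie_j=0$ for $i\neq j$. An evolution ideal of $A$ is an ideal of $A$ which, as an algebra, has a natural basis; $\{0\}$ is an evolution ideal (with empty natural basis). For $T\subseteq A$, $\operatorname{MinEvid}(T)$ is the set of evolution ideals of $A$ that are minimal (for inclusion) among the evolution ideals of $A$ containing $T$, and $\operatorname{MaxEvid}(T)$ is the set of evolution ideals of $A$ that are maximal among the evolution ideals of $A$ contained in $T$. $\operatorname{Evido}(S)$ is the set of all evolution ideals of $A$ containing $S$; $\operatorname{Evidb}(S)$ is the set of all evolution ideals of $A$ contained in $S$. A lattice definable over $S$ is a triple $(H,f',g')$ where $H\subseteq\operatorname{Evido}(S)$ is ordered by inclusion and $f',g'$ are maps from the set of two-element subsets of $H$ to $H$ such that for all distinct $X,Y\in H$: $f'(\{X,Y\})\in\operatorname{MaxEvid}(X\cap Y)$, $g'(\{X,Y\})\in\operatorname{MinEvid}(X\cup Y)$, and $f'(\{X,Y\})$, $g'(\{X,Y\})$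 are respectively the infimum and the supremum of $\{X,Y\}$ in the ordered set $(H,\subseteq)$ (so $H$ is a lattice with these operations; the empty set is accepted as a lattice). A lattice definable below $S$ is defined in the same way with $\operatorname{Evidb}(S)$ in place of $\operatorname{Evido}(S)$. For lattices $L,M$ of this kind, $L\leq_{\mathrm{latt}}M$ means that $L\subseteq M$ as sets and, for every two distinct elements $a,b\in L$, $\inf_L(\{a,b\})=\inf_M(\{a,b\})$ and $\sup_L(\{a,b\})=\sup_M(\{a,b\})$. *)

theory Defs
  imports Complex_Main "HOL-Algebra.Lattice" "HOL-Library.FuncSet"
begin

locale nonassoc_algebra = vector_space scale
  for scale :: "'k::field \<Rightarrow> 'a::ab_group_add \<Rightarrow> 'a" (infixr \<open>*s\<close> 75) +
  fixes mult :: "'a \<Rightarrow> 'a \<Rightarrow> 'a" (infixl \<open>\<odot>\<close> 70)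
  assumes linear_mult_right: "Vector_Spaces.linear scale scale (\<lambda>y. x \<odot> y)"
    and linear_mult_left: "Vector_Spaces.linear scale scale (\<lambda>x. x \<odot> y)"
begin

definition ideal :: "'a set \<Rightarrow> bool" where
  "ideal I \<longleftrightarrow> subspace I \<and> (\<forall>a. \<forall>x\<in>I. a \<odot> x \<in> I \<and> x \<odot> a \<in> I)"

definition natural_basis :: "'a set \<Rightarrow> 'a set \<Rightarrow> bool" where
  "natural_basis I B \<longleftrightarrow>
     independent B \<and> span B = I \<and> (\<forall>x\<in>B. \<forall>y\<in>B. x \<noteq> y \<longrightarrow> x \<odot> y = 0)"

definition evolution_ideal :: "'a set \<Rightarrow> bool" where
  "evolution_ideal I \<longleftrightarrow> ideal I \<and> (\<exists>B. natural_basis I B)"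

definition Evido :: "'a set \<Rightarrow> 'a set set" where
  "Evido S = {I. evolution_ideal I \<and> S \<subseteq> I}"

definition Evidb :: "'a set \<Rightarrow> 'a set set" where
  "Evidb S = {I. evolution_ideal I \<and> I \<subseteq> S}"

definition MinEvid :: "'a set \<Rightarrow> 'a set set" where
  "MinEvid T = {I \<in> Evido T. \<forall>J \<in> Evido T. J \<subseteq> I \<longrightarrow> J = I}"

definition MaxEvid :: "'a set \<Rightarrow> 'a set set" where
  "MaxEvid T = {I \<in> Evidb T. \<forall>J \<in> Evidb T. I \<subseteq> J \<longrightarrow> J = I}"

end

definition incl_order :: "'a set set \<Rightarrow> 'a set gorder" where
  "incl_order H = \<lparr>carrier = H, eq = (=), le = (\<subseteq>)\<rparr>"

definition two_subsets :: "'b set \<Rightarrow> 'b set set" where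
  "two_subsets H = {P. P \<subseteq> H \<and> card P = 2}"

(* The operations are extensional functions on the two-element subsets, so that equality of
   triples is equality of the carriers and of the operations on them. *)
type_synonym 'a evlattice =
  "'a set set \<times> ('a set set \<Rightarrow> 'a set) \<times> ('a set set \<Rightarrow> 'a set)"

context nonassoc_algebra
begin

definition lattice_within :: "'a set set \<Rightarrow> 'a evlattice \<Rightarrow> bool" where
  "lattice_within E = (\<lambda>(H, f, g).
     H \<subseteq> E \<and> f \<in> two_subsets H \<rightarrow>\<^sub>E H \<and> g \<in> two_subsets H \<rightarrow>\<^sub>E H \<and>
     (\<forall>X\<in>H. \<forall>Y\<in>H. X \<noteq> Y \<longrightarrow>
        f {X, Y} \<in> MaxEvid (X \<inter> Y) \<and>
        g {X, Y} \<in> MinEvid (X \<union> Y) \<and>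
        greatest (incl_order H) (f {X, Y}) (Lower (incl_order H) {X, Y}) \<and>
        least (incl_order H) (g {X, Y}) (Upper (incl_order H) {X, Y})))"

definition lattices_over :: "'a set \<Rightarrow> 'a evlattice set" where
  "lattices_over S = {L. lattice_within (Evido S) L}"

definition lattices_below :: "'a set \<Rightarrow> 'a evlattice set" where
  "lattices_below S = {L. lattice_within (Evidb S) L}"

end

definition latt_le :: "'a evlattice \<Rightarrow> 'a evlattice \<Rightarrow> bool" (infix \<open>\<le>\<^sub>l\<^sub>a\<^sub>t\<^sub>t\<close> 50) where
  "L \<le>\<^sub>l\<^sub>a\<^sub>t\<^sub>t M \<longleftrightarrow>
     fst L \<subseteq> fst M \<and>
     (\<forall>a\<in>fst L. \<forall>b\<in>fst L. a \<noteq> b \<longrightarrow>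
        \<Sqinter>\<^bsub>incl_order (fst L)\<^esub>{a, b} = \<Sqinter>\<^bsub>incl_order (fst M)\<^esub>{a, b} \<and>
        \<Squnion>\<^bsub>incl_order (fst L)\<^esub>{a, b} = \<Squnion>\<^bsub>incl_order (fst M)\<^esub>{a, b})"

definition latt_maximal :: "'a evlattice set \<Rightarrow> 'a evlattice \<Rightarrow> bool" where
  "latt_maximal \<L> M \<longleftrightarrow> M \<in> \<L> \<and> (\<forall>N\<in>\<L>. M \<le>\<^sub>l\<^sub>a\<^sub>t\<^sub>t N \<longrightarrow> N = M)"

end

theory Submission
  imports Defs
begin

text \<open>
  The infimum and the supremum in a lattice determine its operations, so the order on
  lattices is extension of the operations. For a chain, the union of the carriers with the
  union of the operations is again a lattice: two elements, and any third one competing with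
  their infimum or supremum, lie in a common member of the chain, and the conditions involving
  \<^term>\<open>MaxEvid\<close> and \<^term>\<open>MinEvid\<close> do not depend on the carrier. Zorn's lemma applies.
\<close>

text \<open>\<open>Lower\<close> tests only against members of the carrier, hence the assumption
  that \<open>X\<close> and \<open>Y\<close> lie in \<open>H\<close>. Under it the infimum condition
  becomes a statement about plain inclusions.\<close>

lemma greatest_incl_order_iff:
  assumes "X \<in> H" "Y \<in> H"
  shows "greatest (incl_order H) Z (Lower (incl_order H) {X, Y}) \<longleftrightarrow>
    Z \<in> H \<and> Z \<subseteq> X \<and> Z \<subseteq> Y \<and> (\<forall>W\<in>H. W \<subseteq> X \<longrightarrow> W \<subseteq> Y \<longrightarrow> W \<subseteq> Z)"
proof -
  have "Lower (incl_order H) {X, Y} = {W \<in> H. W \<subseteq> X \<and> W \<subseteq> Y}"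
    using assms unfolding Lower_def incl_order_def by simp blast
  then show ?thesis
    unfolding greatest_def by (simp add: incl_order_def) blast
qed

lemma least_incl_order_iff:
  assumes "X \<in> H" "Y \<in> H"
  shows "least (incl_order H) Z (Upper (incl_order H) {X, Y}) \<longleftrightarrow>
    Z \<in> H \<and> X \<subseteq> Z \<and> Y \<subseteq> Z \<and> (\<forall>W\<in>H. X \<subseteq> W \<longrightarrow> Y \<subseteq> W \<longrightarrow> Z \<subseteq> W)"
proof -
  have "Upper (incl_order H) {X, Y} = {W \<in> H. X \<subseteq> W \<and> Y \<subseteq> W}"
    using assms unfolding Upper_def incl_order_def by simp blast
  then show ?thesis
    unfolding least_def by (simp add: incl_order_def) blast
qed

text \<open>The infimum is defined by Hilbert choice, so its value is pinned down by uniqueness: two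
  greatest lower bounds include each other.\<close>

lemma inf_incl_order_eq:
  assumes "X \<in> H" "Y \<in> H" "greatest (incl_order H) Z (Lower (incl_order H) {X, Y})"
  shows "\<Sqinter>\<^bsub>incl_order H\<^esub>{X, Y} = Z"
  unfolding inf_def
proof (rule some_equality)
  fix W assume "greatest (incl_order H) W (Lower (incl_order H) {X, Y})"
  then show "W = Z" using assms by (simp add: greatest_incl_order_iff subset_antisym)
qed (rule assms)

lemma sup_incl_order_eq:
  assumes "X \<in> H" "Y \<in> H" "least (incl_order H) Z (Upper (incl_order H) {X, Y})"
  shows "\<Squnion>\<^bsub>incl_order H\<^esub>{X, Y} = Z"
  unfolding sup_def
proof (rule some_equality)
  fix W assume "least (incl_order H) W (Upper (incl_order H) {X, Y})"
  then show "W = Z" using assms by (simp add: least_incl_order_iff subset_antisym)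
qed (rule assms)

lemma two_subsets_iff:
  "P \<in> two_subsets H \<longleftrightarrow> (\<exists>X\<in>H. \<exists>Y\<in>H. X \<noteq> Y \<and> P = {X, Y})"
  unfolding two_subsets_def card_2_iff by blast

lemma ball_two_subsets:
  "(\<forall>P\<in>two_subsets H. Q P) \<longleftrightarrow> (\<forall>X\<in>H. \<forall>Y\<in>H. X \<noteq> Y \<longrightarrow> Q {X, Y})"
  unfolding two_subsets_iff Ball_def by blast

lemma two_subsets_mono: "H \<subseteq> K \<Longrightarrow> two_subsets H \<subseteq> two_subsets K"
  by (auto simp: two_subsets_def)

lemma latt_le_refl: "L \<le>\<^sub>l\<^sub>a\<^sub>t\<^sub>t L"
  by (simp add: latt_le_def)

lemma latt_le_trans: "L \<le>\<^sub>l\<^sub>a\<^sub>t\<^sub>t M \<Longrightarrow> M \<le>\<^sub>l\<^sub>a\<^sub>t\<^sub>t N \<Longrightarrow> L \<le>\<^sub>l\<^sub>a\<^sub>t\<^sub>t N"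
  unfolding latt_le_def by (simp add: subset_iff)

context nonassoc_algebra
begin

text \<open>A greatest lower or least upper bound lies in the carrier by definition, so the
  operations map into \<open>H\<close> automatically; of the two function space conditions only
  extensionality remains to be checked.\<close>

lemma lattice_within_iff:
  "lattice_within E (H, f, g) \<longleftrightarrow>
     H \<subseteq> E \<and> f \<in> extensional (two_subsets H) \<and> g \<in> extensional (two_subsets H) \<and>
     (\<forall>X\<in>H. \<forall>Y\<in>H. X \<noteq> Y \<longrightarrow>
        f {X, Y} \<in> MaxEvid (X \<inter> Y) \<and> g {X, Y} \<in> MinEvid (X \<union> Y) \<and>
        greatest (incl_order H) (f {X, Y}) (Lower (incl_order H) {X, Y}) \<and>
        least (incl_order H) (g {X, Y}) (Upper (incl_order H) {X, Y}))"
  (is "_ \<longleftrightarrow> ?R")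
proof
  assume ?R
  then have "f P \<in> H \<and> g P \<in> H" if "P \<in> two_subsets H" for P
    using that by (auto simp: two_subsets_iff greatest_incl_order_iff least_incl_order_iff)
  with \<open>?R\<close> show "lattice_within E (H, f, g)"
    by (auto simp: lattice_within_def PiE_def)
qed (auto simp: lattice_within_def PiE_def)

text \<open>On each carrier the chosen infimum and supremum are the values of the operations. For
  the larger lattice this needs \<open>X\<close> and \<open>Y\<close> in \<open>H'\<close>, hence
  the case split; without inclusion both sides are false.\<close>

lemma latt_le_iff_extends:
  assumes "lattice_within E (H, f, g)" "lattice_within E (H', f', g')"
  shows "(H, f, g) \<le>\<^sub>l\<^sub>a\<^sub>t\<^sub>t (H', f', g') \<longleftrightarrow>
    H \<subseteq> H' \<and> (\<forall>P\<in>two_subsets H. f P = f' P \<and> g P = g' P)"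
proof (cases "H \<subseteq> H'")
  case True
  have "\<Sqinter>\<^bsub>incl_order H\<^esub>{X, Y} = f {X, Y} \<and> \<Squnion>\<^bsub>incl_order H\<^esub>{X, Y} = g {X, Y} \<and>
        \<Sqinter>\<^bsub>incl_order H'\<^esub>{X, Y} = f' {X, Y} \<and> \<Squnion>\<^bsub>incl_order H'\<^esub>{X, Y} = g' {X, Y}"
    if "X \<in> H" "Y \<in> H" "X \<noteq> Y" for X Y
    using assms that subsetD[OF True] unfolding lattice_within_iff
    by (intro conjI inf_incl_order_eq sup_incl_order_eq) simp_all
  with True show ?thesis
    by (simp add: latt_le_def ball_two_subsets cong: ball_cong)
qed (simp add: latt_le_def)

text \<open>The order only compares operations on two-element subsets of the carrier; extensionality
  fixes them elsewhere, which gives equality of the triples.\<close>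

lemma latt_le_antisym:
  assumes "lattice_within E L" "lattice_within E M" "L \<le>\<^sub>l\<^sub>a\<^sub>t\<^sub>t M" "M \<le>\<^sub>l\<^sub>a\<^sub>t\<^sub>t L"
  shows "L = M"
proof -
  obtain H f g H' f' g' where LM: "L = (H, f, g)" "M = (H', f', g')"
    by (metis prod_cases3)
  have le: "H \<subseteq> H' \<and> (\<forall>P\<in>two_subsets H. f P = f' P \<and> g P = g' P)" "H' \<subseteq> H"
    using assms(3,4) latt_le_iff_extends[OF assms(1,2)[unfolded LM]]
      latt_le_iff_extends[OF assms(2,1)[unfolded LM]] by (simp_all add: LM)
  then have H: "H' = H" by simp
  have "f \<in> extensional (two_subsets H)" "g \<in> extensional (two_subsets H)"
    "f' \<in> extensional (two_subsets H)" "g' \<in> extensional (two_subsets H)"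
    using assms(1,2) by (simp_all add: LM H lattice_within_iff)
  then have "f = f'" "g = g'"
    using le(1) by (auto intro: extensionalityI)
  then show ?thesis
    by (simp add: LM H)
qed

lemma latt_chain_upper_bound:
  assumes lat: "\<And>L. L \<in> C \<Longrightarrow> lattice_within E L"
    and chain: "\<And>L M. L \<in> C \<Longrightarrow> M \<in> C \<Longrightarrow> L \<le>\<^sub>l\<^sub>a\<^sub>t\<^sub>t M \<or> M \<le>\<^sub>l\<^sub>a\<^sub>t\<^sub>t L"
  shows "\<exists>U. lattice_within E U \<and> (\<forall>L\<in>C. L \<le>\<^sub>l\<^sub>a\<^sub>t\<^sub>t U)"
proof -
  define K where "K = \<Union> (fst ` C)"
  \<comment> \<open>An arbitrary member of the chain whose carrier contains the pair;
    \<open>agree\<close> makes the values of \<open>F\<close> and \<open>G\<close> independent of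
    this choice.\<close>
  define pick where "pick P = (SOME L. L \<in> C \<and> P \<in> two_subsets (fst L))" for P
  define F where "F = (\<lambda>P\<in>two_subsets K. fst (snd (pick P)) P)"
  define G where "G = (\<lambda>P\<in>two_subsets K. snd (snd (pick P)) P)"
  have agree: "f P = f' P \<and> g P = g' P"
    if "(H, f, g) \<in> C" "(H', f', g') \<in> C" "P \<in> two_subsets H" "P \<in> two_subsets H'"
    for H f g H' f' g' P
    using chain[OF that(1,2)] latt_le_iff_extends[OF lat[OF that(1)] lat[OF that(2)]]
      latt_le_iff_extends[OF lat[OF that(2)] lat[OF that(1)]] that(3,4) by auto
  have FG: "F P = f P \<and> G P = g P" if "(H, f, g) \<in> C" "P \<in> two_subsets H" for H f g P
  proof -
    have "pick P \<in> C \<and> P \<in> two_subsets (fst (pick P))"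
      unfolding pick_def by (rule someI[of _ "(H, f, g)"]) (use that in simp)
    moreover have "P \<in> two_subsets K"
      using that two_subsets_mono[of H K] by (force simp: K_def)
    ultimately show ?thesis
      using agree[of "fst (pick P)" "fst (snd (pick P))" "snd (snd (pick P))", OF _ that(1) _ that(2)]
      by (simp add: F_def G_def)
  qed
  \<comment> \<open>Three elements, not two: \<open>W\<close> is the competitor against which a
    bound of \<open>X\<close> and \<open>Y\<close> is tested.\<close>
  have common: "\<exists>H f g. (H, f, g) \<in> C \<and> X \<in> H \<and> Y \<in> H \<and> W \<in> H"
    if XYW: "X \<in> K" "Y \<in> K" "W \<in> K" for X Y W
  proof -
    have up: "\<exists>N\<in>C. fst L \<subseteq> fst N \<and> fst M \<subseteq> fst N" if "L \<in> C" "M \<in> C" for L M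
      using chain[OF that] that by (auto simp: latt_le_def)
    obtain L1 L2 L3 where "L1 \<in> C" "L2 \<in> C" "L3 \<in> C" "X \<in> fst L1" "Y \<in> fst L2" "W \<in> fst L3"
      using XYW by (auto simp: K_def)
    with up[of L1 L2] up[of _ L3] have "\<exists>N\<in>C. X \<in> fst N \<and> Y \<in> fst N \<and> W \<in> fst N"
      by (meson subsetD)
    then show ?thesis by (metis prod.collapse)
  qed
  \<comment> \<open>The competitor \<open>W\<close> is fixed before the member of the chain is
    chosen, since a single member need not contain all competitors in \<open>K\<close>.\<close>
  have local: "F {X, Y} \<in> MaxEvid (X \<inter> Y) \<and> G {X, Y} \<in> MinEvid (X \<union> Y) \<and>
      F {X, Y} \<in> K \<and> F {X, Y} \<subseteq> X \<and> F {X, Y} \<subseteq> Y \<and>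
      G {X, Y} \<in> K \<and> X \<subseteq> G {X, Y} \<and> Y \<subseteq> G {X, Y} \<and>
      (W \<subseteq> X \<longrightarrow> W \<subseteq> Y \<longrightarrow> W \<subseteq> F {X, Y}) \<and> (X \<subseteq> W \<longrightarrow> Y \<subseteq> W \<longrightarrow> G {X, Y} \<subseteq> W)"
    if XYW: "X \<in> K" "Y \<in> K" "W \<in> K" and neq: "X \<noteq> Y" for X Y W
  proof -
    obtain H f g where C: "(H, f, g) \<in> C" and H: "X \<in> H" "Y \<in> H" "W \<in> H"
      using common XYW by blast
    have eq: "F {X, Y} = f {X, Y}" "G {X, Y} = g {X, Y}"
      using FG[OF C, of "{X, Y}"] H neq by (auto simp: two_subsets_iff)
    have "H \<subseteq> K" using C by (force simp: K_def)
    then show ?thesis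
      using lat[OF C, unfolded lattice_within_iff] H neq subsetD[OF \<open>H \<subseteq> K\<close>]
      by (simp add: eq greatest_incl_order_iff least_incl_order_iff)
  qed
  have "K \<subseteq> E"
    using lat by (fastforce simp: K_def lattice_within_def)
  moreover have "F \<in> extensional (two_subsets K)" "G \<in> extensional (two_subsets K)"
    by (simp_all add: F_def G_def)
  moreover have "F {X, Y} \<in> MaxEvid (X \<inter> Y) \<and> G {X, Y} \<in> MinEvid (X \<union> Y) \<and>
      greatest (incl_order K) (F {X, Y}) (Lower (incl_order K) {X, Y}) \<and>
      least (incl_order K) (G {X, Y}) (Upper (incl_order K) {X, Y})"
    if "X \<in> K" "Y \<in> K" "X \<noteq> Y" for X Y
    \<comment> \<open>The instance with \<open>X\<close> as a dummy competitor yields the facts that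
      do not mention \<open>W\<close>; the general one yields the universal properties.\<close>
    using that local[of X Y X] local[of X Y]
    by (simp add: greatest_incl_order_iff least_incl_order_iff)
  ultimately have U: "lattice_within E (K, F, G)"
    unfolding lattice_within_iff by blast
  have "L \<le>\<^sub>l\<^sub>a\<^sub>t\<^sub>t (K, F, G)" if "L \<in> C" for L
  proof -
    obtain H f g where L: "L = (H, f, g)" by (rule prod_cases3)
    have "H \<subseteq> K" using that by (force simp: K_def L)
    then show ?thesis
      using latt_le_iff_extends[OF lat[OF that, unfolded L] U] FG that by (simp add: L)
  qed
  with U show ?thesis by blast
qed

lemma ex_latt_maximal_above:
  assumes L: "lattice_within E L"
  shows "\<exists>M. latt_maximal {N. lattice_within E N} M \<and> L \<le>\<^sub>l\<^sub>a\<^sub>t\<^sub>t M"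
proof -
  \<comment> \<open>Zorn's lemma is applied only to the lattices above \<open>L\<close>, so that the
    maximal element obtained extends \<open>L\<close>.\<close>
  define A where "A = {N. lattice_within E N \<and> L \<le>\<^sub>l\<^sub>a\<^sub>t\<^sub>t N}"
  have "\<exists>M\<in>A. \<forall>N\<in>A. M \<le>\<^sub>l\<^sub>a\<^sub>t\<^sub>t N \<longrightarrow> N = M"
  proof (rule predicate_Zorn)
    show "partial_order_on A (relation_of (\<le>\<^sub>l\<^sub>a\<^sub>t\<^sub>t) A)"
      unfolding A_def
      by (rule partial_order_on_relation_ofI)
        (blast intro: latt_le_refl latt_le_trans latt_le_antisym)+
  next
    fix C assume "C \<in> Chains (relation_of (\<le>\<^sub>l\<^sub>a\<^sub>t\<^sub>t) A)"
    then have C: "N \<in> C \<Longrightarrow> lattice_within E N \<and> L \<le>\<^sub>l\<^sub>a\<^sub>t\<^sub>t N"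
      and chain: "M \<in> C \<Longrightarrow> N \<in> C \<Longrightarrow> M \<le>\<^sub>l\<^sub>a\<^sub>t\<^sub>t N \<or> N \<le>\<^sub>l\<^sub>a\<^sub>t\<^sub>t M" for M N
      unfolding Chains_def relation_of_def A_def by blast+
    \<comment> \<open>Inserting \<open>L\<close> keeps \<open>C\<close> a chain and forces the bound
      into \<open>A\<close> even when \<open>C\<close> is empty.\<close>
    have "\<exists>U. lattice_within E U \<and> (\<forall>N\<in>insert L C. N \<le>\<^sub>l\<^sub>a\<^sub>t\<^sub>t U)"
    proof (rule latt_chain_upper_bound)
      show "lattice_within E N" if "N \<in> insert L C" for N
        using that C L by blast
      show "M \<le>\<^sub>l\<^sub>a\<^sub>t\<^sub>t N \<or> N \<le>\<^sub>l\<^sub>a\<^sub>t\<^sub>t M" if "M \<in> insert L C" "N \<in> insert L C" for M N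
        using that C chain latt_le_refl by blast
    qed
    then show "\<exists>U\<in>A. \<forall>N\<in>C. N \<le>\<^sub>l\<^sub>a\<^sub>t\<^sub>t U"
      unfolding A_def by blast
  qed
  \<comment> \<open>Any lattice above an element of \<open>A\<close> is itself in \<open>A\<close>
    by transitivity, so maximality in \<open>A\<close> is maximality among all lattices within
    \<open>E\<close>.\<close>
  then show ?thesis
    unfolding A_def latt_maximal_def by (blast intro: latt_le_trans)
qed

end

theorem theorem30:
  fixes scale :: "'k::field \<Rightarrow> 'a::ab_group_add \<Rightarrow> 'a"
    and mult :: "'a \<Rightarrow> 'a \<Rightarrow> 'a"
    and S :: "'a set"
  assumes "nonassoc_algebra scale mult"
    and "\<exists>Basis. finite_dimensional_vector_space scale Basis"
  shows "(\<forall>L \<in> nonassoc_algebra.lattices_over scale mult S.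
            \<exists>M. latt_maximal (nonassoc_algebra.lattices_over scale mult S) M \<and> L \<le>\<^sub>l\<^sub>a\<^sub>t\<^sub>t M) \<and>
         (\<forall>L \<in> nonassoc_algebra.lattices_below scale mult S.
            \<exists>M. latt_maximal (nonassoc_algebra.lattices_below scale mult S) M \<and> L \<le>\<^sub>l\<^sub>a\<^sub>t\<^sub>t M)"
proof -
  interpret nonassoc_algebra scale mult by (rule assms)
  show ?thesis
    unfolding lattices_over_def lattices_below_def using ex_latt_maximal_above by blast
qed

end
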